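(* Under the setting of the Jacobian formula ($\beta\in(0,1)$, $p\in(1,2]$, $\zeta>0$), the map $x\mapsto J(x)=-TB^\dagger K(x)B$ is Lipschitz continuous on $\mathbb{R}^n$ with respect to the Euclidean norm and the induced operator 2-norm: there exists $\xi\ge0$ with $\lVert J(x)-J(y)\rVert_2\le\xi\lVert x-y\rVert_2$ for all $x,y\in\mathbb{R}^n$.
   Context: $T=\beta D+D^{-1}L$ with $D$ the weighted degree matrix and $L=D-A$ the Laplacian of a simple connected weighted graph with $n$ vertices and $m\ge1$ edges; $B$ the incidence matrix, $B^\dagger$ its Moore–Penrose inverse; with $z=Bx$, $K(x)=\operatorname{diag}\big((z_i^2+\zeta)^{\frac12(p-2)}+(p-2)z_i^2(z_i^2+\zeta)^{\frac12(p-4)}\big)_{i=1}^m$. *)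

theory Defs
  imports "HOL-Analysis.Analysis"
begin

text \<open>Graph data: vertices are the elements of a finite type 'n, edges the elements
  of a finite type 'm. Edge e joins src e and tgt e (an arbitrary fixed orientation)
  and carries weight w e.\<close>

definition simple_connected_weighted_graph ::
  "('m::finite \<Rightarrow> 'n::finite) \<Rightarrow> ('m \<Rightarrow> 'n) \<Rightarrow> ('m \<Rightarrow> real) \<Rightarrow> bool" where
  "simple_connected_weighted_graph src tgt w \<longleftrightarrow>
     (\<forall>e. src e \<noteq> tgt e) \<and>
     inj (\<lambda>e. {src e, tgt e}) \<and>
     (\<forall>e. w e > 0) \<and>
     (\<forall>i j. (i, j) \<in> ({(src e, tgt e) | e. True} \<union> {(tgt e, src e) | e. True})\<^sup>*)"

text \<open>Weighted adjacency matrix A.\<close>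
definition adj_mat :: "('m::finite \<Rightarrow> 'n::finite) \<Rightarrow> ('m \<Rightarrow> 'n) \<Rightarrow> ('m \<Rightarrow> real) \<Rightarrow> real^'n^'n" where
  "adj_mat src tgt w = (\<chi> i j. \<Sum>e\<in>{e. {src e, tgt e} = {i, j}}. w e)"

text \<open>Weighted degree matrix D.\<close>
definition deg_mat :: "('m::finite \<Rightarrow> 'n::finite) \<Rightarrow> ('m \<Rightarrow> 'n) \<Rightarrow> ('m \<Rightarrow> real) \<Rightarrow> real^'n^'n" where
  "deg_mat src tgt w = (\<chi> i j. if i = j then (\<Sum>k\<in>UNIV. adj_mat src tgt w $ i $ k) else 0)"

text \<open>Laplacian L = D - A.\<close>
definition lap_mat :: "('m::finite \<Rightarrow> 'n::finite) \<Rightarrow> ('m \<Rightarrow> 'n) \<Rightarrow> ('m \<Rightarrow> real) \<Rightarrow> real^'n^'n" where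
  "lap_mat src tgt w = deg_mat src tgt w - adj_mat src tgt w"

text \<open>Oriented (unweighted) incidence matrix B (m x n): row e has +1 at src e, -1 at tgt e.\<close>
definition inc_mat :: "('m::finite \<Rightarrow> 'n::finite) \<Rightarrow> ('m \<Rightarrow> 'n) \<Rightarrow> real^'n^'m" where
  "inc_mat src tgt = (\<chi> e i. if i = src e then 1 else if i = tgt e then -1 else 0)"

text \<open>Moore--Penrose inverse, defined by the four Penrose conditions.\<close>
definition mp_pinv :: "real^'b::finite^'a::finite \<Rightarrow> real^'a^'b" where
  "mp_pinv A = (THE X. A ** X ** A = A \<and> X ** A ** X = X \<and>
       transpose (A ** X) = A ** X \<and> transpose (X ** A) = X ** A)"

text \<open>T = beta D + D^{-1} L.\<close>
definition T_mat :: "real \<Rightarrow> ('m::finite \<Rightarrow> 'n::finite) \<Rightarrow> ('m \<Rightarrow> 'n) \<Rightarrow> ('m \<Rightarrow> real) \<Rightarrow> real^'n^'n" where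
  "T_mat \<beta> src tgt w = \<beta> *\<^sub>R deg_mat src tgt w + matrix_inv (deg_mat src tgt w) ** lap_mat src tgt w"

text \<open>K(x) = diag((z_i^2+zeta)^((p-2)/2) + (p-2) z_i^2 (z_i^2+zeta)^((p-4)/2)), z = Bx.\<close>
definition K_mat :: "real \<Rightarrow> real \<Rightarrow> ('m::finite \<Rightarrow> 'n::finite) \<Rightarrow> ('m \<Rightarrow> 'n) \<Rightarrow> real^'n \<Rightarrow> real^'m^'m" where
  "K_mat p \<zeta> src tgt x = (let z = inc_mat src tgt *v x in
     (\<chi> i j. if i = j then (z$i ^ 2 + \<zeta>) powr ((p - 2) / 2)
                         + (p - 2) * z$i ^ 2 * (z$i ^ 2 + \<zeta>) powr ((p - 4) / 2)
             else 0))"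

text \<open>Jacobian J(x) = - T B^dagger K(x) B.\<close>
definition J_mat :: "real \<Rightarrow> real \<Rightarrow> real \<Rightarrow> ('m::finite \<Rightarrow> 'n::finite) \<Rightarrow> ('m \<Rightarrow> 'n) \<Rightarrow> ('m \<Rightarrow> real)
     \<Rightarrow> real^'n \<Rightarrow> real^'n^'n" where
  "J_mat \<beta> p \<zeta> src tgt w x =
     - (T_mat \<beta> src tgt w ** mp_pinv (inc_mat src tgt) ** K_mat p \<zeta> src tgt x ** inc_mat src tgt)"

end

theory Submission
  imports Defs
begin

(* Only K depends on x, so J(x) - J(y) = (T B^+) diag(k(Bx) - k(By)) B, where k is the scalar
   weight applied entrywise. For p <= 2 the derivative of k is bounded on all of R, because
   (t^2 + zeta) powr ((p-2)/2) <= zeta powr ((p-2)/2) and |t| / (t^2 + zeta) <= 1 / (2 sqrt zeta);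
   hence k is L-Lipschitz, and as the operator norm of a diagonal matrix is at most its largest
   entry, xi = ||T B^+|| L ||B||^2 works. T and B^+ enter only as one fixed matrix. *)

definition diag_mat :: "('m::finite \<Rightarrow> real) \<Rightarrow> real^'m^'m" where
  "diag_mat d = (\<chi> i j. if i = j then d i else 0)"

lemma diag_mat_mult_vec: "diag_mat d *v v = (\<chi> i. d i * v $ i)"
  by (simp add: diag_mat_def matrix_vector_mult_def if_distrib if_distribR cong: if_cong)

lemma diag_mat_diff: "diag_mat d - diag_mat e = diag_mat (\<lambda>i. d i - e i)"
  by (vector diag_mat_def)

lemma onorm_diag_mat_le:
  fixes d :: "'m::finite \<Rightarrow> real"
  assumes "\<And>i. \<bar>d i\<bar> \<le> c"
  shows "onorm ((*v) (diag_mat d)) \<le> c"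
proof (rule onorm_bound)
  show "0 \<le> c" using assms[of undefined] by linarith
  fix v :: "real^'m"
  have "norm (diag_mat d *v v) = L2_set (\<lambda>i. \<bar>d i\<bar> * \<bar>v $ i\<bar>) UNIV"
    by (simp add: diag_mat_mult_vec norm_vec_def abs_mult)
  also have "\<dots> \<le> L2_set (\<lambda>i. c * \<bar>v $ i\<bar>) UNIV"
    by (rule L2_set_mono) (simp_all add: assms mult_right_mono)
  also have "\<dots> = c * norm v"
    using \<open>0 \<le> c\<close> by (simp add: norm_vec_def L2_set_right_distrib)
  finally show "norm (diag_mat d *v v) \<le> c * norm v" .
qed

lemma onorm_matrix_mult_le:
  fixes A :: "real^'n::finite^'m::finite" and B :: "real^'k::finite^'n"
  shows "onorm ((*v) (A ** B)) \<le> onorm ((*v) A) * onorm ((*v) B)"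
proof -
  have "(*v) (A ** B) = (*v) A \<circ> (*v) B"
    by (simp add: fun_eq_iff matrix_vector_mul_assoc)
  then show ?thesis
    by (simp add: onorm_compose matrix_vector_mul_bounded_linear)
qed

lemma matrix_diff_ldistrib: "(A::'a::ring_1^'n^'m) ** (B - C) = A ** B - A ** C"
  by (vector matrix_matrix_mult_def sum_subtractf[symmetric] algebra_simps)

lemma matrix_diff_rdistrib: "((A::'a::ring_1^'n^'m) - B) ** C = A ** C - B ** C"
  by (vector matrix_matrix_mult_def sum_subtractf[symmetric] algebra_simps)

lemma onorm_diag_mat_lipschitz_comp_le:
  fixes B :: "real^'n::finite^'m::finite"
  assumes "L-lipschitz_on UNIV f"
  shows "onorm ((*v) (diag_mat (\<lambda>e. f ((B *v x) $ e) - f ((B *v y) $ e))))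
           \<le> L * onorm ((*v) B) * norm (x - y)"
proof (rule onorm_diag_mat_le)
  fix e
  have "\<bar>f ((B *v x) $ e) - f ((B *v y) $ e)\<bar> \<le> L * \<bar>(B *v (x - y)) $ e\<bar>"
    using lipschitz_onD[OF assms, of "(B *v x) $ e" "(B *v y) $ e"]
    by (simp add: dist_real_def matrix_vector_mult_diff_distrib)
  also have "\<dots> \<le> L * (onorm ((*v) B) * norm (x - y))"
    using lipschitz_on_nonneg[OF assms] component_le_norm_cart[of "B *v (x - y)" e]
      onorm[OF matrix_vector_mul_bounded_linear, of B "x - y"]
    by (intro mult_left_mono) auto
  finally show "\<bar>f ((B *v x) $ e) - f ((B *v y) $ e)\<bar> \<le> L * onorm ((*v) B) * norm (x - y)"
    by (simp add: mult.assoc)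
qed

definition K_diag :: "real \<Rightarrow> real \<Rightarrow> real \<Rightarrow> real" where
  "K_diag p \<zeta> t = (t\<^sup>2 + \<zeta>) powr ((p - 2) / 2) + (p - 2) * t\<^sup>2 * (t\<^sup>2 + \<zeta>) powr ((p - 4) / 2)"

lemma K_mat_eq_diag_mat:
  "K_mat p \<zeta> src tgt x = diag_mat (\<lambda>e. K_diag p \<zeta> ((inc_mat src tgt *v x) $ e))"
  by (simp add: K_mat_def K_diag_def diag_mat_def Let_def)

definition K_diag_deriv :: "real \<Rightarrow> real \<Rightarrow> real \<Rightarrow> real" where
  "K_diag_deriv p \<zeta> t = (p - 2) * t * (t\<^sup>2 + \<zeta>) powr ((p - 4) / 2) * (3 + (p - 4) * t\<^sup>2 / (t\<^sup>2 + \<zeta>))"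

lemma K_diag_has_real_derivative:
  assumes "0 < \<zeta>"
  shows "(K_diag p \<zeta> has_real_derivative K_diag_deriv p \<zeta> t) (at t)"
proof -
  define s where "s = t\<^sup>2 + \<zeta>"
  have s: "0 < s" using assms by (simp add: s_def add_nonneg_pos)
  have e1: "s powr ((p - 2) / 2 - 1) = s powr ((p - 4) / 2)"
    by (simp add: field_simps)
  have e2: "s powr ((p - 4) / 2 - 1) = s powr ((p - 4) / 2) / s"
    using s by (subst powr_diff) simp
  show ?thesis
    unfolding K_diag_def K_diag_deriv_def
    apply (rule derivative_eq_intros refl | simp add: add_nonneg_pos assms)+
    unfolding s_def[symmetric] e1 e2 using s by (simp add: field_simps power2_eq_square)
qed

lemma abs_div_square_add_le:
  fixes t z :: real
  assumes "0 < z"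
  shows "\<bar>t\<bar> / (t\<^sup>2 + z) \<le> 1 / (2 * sqrt z)"
proof -
  have "2 * \<bar>t\<bar> * sqrt z \<le> t\<^sup>2 + z"
    using sum_squares_bound[of "\<bar>t\<bar>" "sqrt z"] assms by (simp add: power2_abs)
  moreover have "0 < t\<^sup>2 + z" using assms by (simp add: add_nonneg_pos)
  ultimately show ?thesis using assms by (simp add: field_simps)
qed

lemma abs_K_diag_deriv_le:
  assumes "0 < \<zeta>" "p \<le> 2"
  shows "\<bar>K_diag_deriv p \<zeta> t\<bar> \<le> \<bar>p - 2\<bar> * (1 / (2 * sqrt \<zeta>)) * \<zeta> powr ((p - 2) / 2) * (3 + \<bar>p - 4\<bar>)"
proof -
  define s where "s = t\<^sup>2 + \<zeta>"
  have s: "0 < s" "\<zeta> \<le> s" "t\<^sup>2 \<le> s" using assms by (auto simp: s_def add_nonneg_pos)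
  have "s powr ((p - 4) / 2) = s powr ((p - 2) / 2 - 1)"
    by (simp add: field_simps)
  also have "\<dots> = s powr ((p - 2) / 2) / s"
    using s by (subst powr_diff) simp
  finally have "\<bar>K_diag_deriv p \<zeta> t\<bar>
      = \<bar>p - 2\<bar> * (\<bar>t\<bar> / s) * s powr ((p - 2) / 2) * \<bar>3 + (p - 4) * (t\<^sup>2 / s)\<bar>"
    using s by (simp add: K_diag_deriv_def s_def[symmetric] abs_mult)
  also have "\<dots> \<le> \<bar>p - 2\<bar> * (1 / (2 * sqrt \<zeta>)) * \<zeta> powr ((p - 2) / 2) * (3 + \<bar>p - 4\<bar>)"
  proof (intro mult_mono mult_nonneg_nonneg)
    show "\<bar>t\<bar> / s \<le> 1 / (2 * sqrt \<zeta>)"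
      unfolding s_def by (rule abs_div_square_add_le[OF assms(1)])
    show "s powr ((p - 2) / 2) \<le> \<zeta> powr ((p - 2) / 2)"
      using s assms by (intro powr_mono2') auto
    have "\<bar>(p - 4) * (t\<^sup>2 / s)\<bar> \<le> \<bar>p - 4\<bar>"
      unfolding abs_mult using s by (intro mult_left_le) auto
    then show "\<bar>3 + (p - 4) * (t\<^sup>2 / s)\<bar> \<le> 3 + \<bar>p - 4\<bar>" by linarith
  qed (use s assms in auto)
  finally show ?thesis .
qed

lemma K_diag_lipschitz:
  assumes "0 < \<zeta>" "p \<le> 2"
  shows "(\<bar>p - 2\<bar> * (1 / (2 * sqrt \<zeta>)) * \<zeta> powr ((p - 2) / 2) * (3 + \<bar>p - 4\<bar>))-lipschitz_on
           UNIV (K_diag p \<zeta>)"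
proof (rule lipschitz_onI)
  fix u v :: real
  show "dist (K_diag p \<zeta> u) (K_diag p \<zeta> v)
          \<le> \<bar>p - 2\<bar> * (1 / (2 * sqrt \<zeta>)) * \<zeta> powr ((p - 2) / 2) * (3 + \<bar>p - 4\<bar>) * dist u v"
    unfolding dist_real_def real_norm_def[symmetric]
    by (rule field_differentiable_bound[of UNIV _ "K_diag_deriv p \<zeta>"])
      (use K_diag_has_real_derivative[OF assms(1)] abs_K_diag_deriv_le[OF assms] in
        \<open>auto simp: has_field_derivative_at_within\<close>)
qed (use assms in simp)

lemma J_mat_diff_eq:
  "J_mat \<beta> p \<zeta> src tgt w x - J_mat \<beta> p \<zeta> src tgt w y =
     (T_mat \<beta> src tgt w ** mp_pinv (inc_mat src tgt))
       ** diag_mat (\<lambda>e. K_diag p \<zeta> ((inc_mat src tgt *v y) $ e) - K_diag p \<zeta> ((inc_mat src tgt *v x) $ e))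
       ** inc_mat src tgt"
  by (simp add: J_mat_def K_mat_eq_diag_mat diag_mat_diff[symmetric]
      matrix_diff_ldistrib matrix_diff_rdistrib)

theorem mainTheorem11:
  fixes src tgt :: "'m::finite \<Rightarrow> 'n::finite" and w :: "'m \<Rightarrow> real"
    and \<beta> p \<zeta> :: real
  assumes "simple_connected_weighted_graph src tgt w"
    and "0 < \<beta>" "\<beta> < 1" and "1 < p" "p \<le> 2" and "0 < \<zeta>"
  shows "\<exists>\<xi>\<ge>0. \<forall>x y :: real^'n.
           onorm (\<lambda>v. (J_mat \<beta> p \<zeta> src tgt w x - J_mat \<beta> p \<zeta> src tgt w y) *v v)
             \<le> \<xi> * norm (x - y)"
proof -
  obtain L where lip: "L-lipschitz_on UNIV (K_diag p \<zeta>)"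
    using K_diag_lipschitz[OF assms(6,5)] by blast
  define N where "N = T_mat \<beta> src tgt w ** mp_pinv (inc_mat src tgt)"
  define nB where "nB = onorm ((*v) (inc_mat src tgt))"
  have "onorm ((*v) (J_mat \<beta> p \<zeta> src tgt w x - J_mat \<beta> p \<zeta> src tgt w y))
          \<le> onorm ((*v) N) * L * nB\<^sup>2 * norm (x - y)" for x y
  proof -
    let ?D = "diag_mat (\<lambda>e. K_diag p \<zeta> ((inc_mat src tgt *v y) $ e) - K_diag p \<zeta> ((inc_mat src tgt *v x) $ e))"
    have "onorm ((*v) (J_mat \<beta> p \<zeta> src tgt w x - J_mat \<beta> p \<zeta> src tgt w y))
          \<le> onorm ((*v) N) * onorm ((*v) ?D) * nB"
      unfolding J_mat_diff_eq N_def[symmetric] nB_def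
      by (rule order_trans[OF onorm_matrix_mult_le mult_right_mono[OF onorm_matrix_mult_le]])
        (simp add: onorm_pos_le)
    also have "\<dots> \<le> onorm ((*v) N) * (L * nB * norm (y - x)) * nB"
      unfolding nB_def
      by (intro mult_mono onorm_diag_mat_lipschitz_comp_le[OF lip] order_refl)
        (simp_all add: onorm_pos_le lipschitz_on_nonneg[OF lip])
    finally show ?thesis by (simp add: power2_eq_square norm_minus_commute mult_ac)
  qed
  moreover have "0 \<le> onorm ((*v) N) * L * nB\<^sup>2"
    using lipschitz_on_nonneg[OF lip] by (simp add: nB_def onorm_pos_le)
  ultimately show ?thesis by blast
qed

end
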